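(* Let $Z_0=pe_1+qe_2$, $\mathcal{V}=\alpha+j\beta=\nu_1e_1+\nu_2e_2$, $C=c_1e_1+c_2e_2\in\mathbb{BC}$ with $\alpha\in\mathbb{R}$, $\beta\in i\mathbb{R}$ and $\alpha+1>|\beta|$. Then the Riemann-Liouville fractional derivative of the bicomplex Miller-Ross function is given by $$D_t^M E_{\mathcal{V},C}(Z_0t)=Z_0^M E_{\mathcal{V}-M,C}(Z_0t),$$ where $M=m_1+jm_2\in\mathbb{BC}$ ($m_1,m_2\in\mathbb{C}(i)$) with $\Re(m_1)>0$.
   Context: Bicomplex numbers: $\mathbb{BC}=\{w_1+jw_2: w_1,w_2\in\mathbb{C}(i)\}$, where $\mathbb{C}(i)$ is the complex field with unit $i$, $i^2=j^2=-1$, $ij=ji$. Put $e_1=\frac{1+ij}{2}$, $e_2=\frac{1-ij}{2}$, so $e_1+e_2=1$, $e_l^2=e_l$, $e_1e_2=0$. Every $Z=w_1+jw_2$ is uniquely $Z=z_1e_1+z_2e_2$ with $z_1=w_1-iw_2$, $z_2=w_1+iw_2\in\mathbb{C}(i)$, and addition, multiplication and division are componentwise in $e_1,e_2$; in particular $\nu_1=\alpha-i\beta$, $\nu_2=\alpha+i\beta$. Functions act componentwise: $\Gamma(Y)=\Gamma(y_1)e_1+\Gamma(y_2)e_2$ for $Y=y_1e_1+y_2e_2$ (with $1/\Gamma$ equal to $0$ at the poles of $\Gamma$), and $Z^{W}=z_1^{w_1}e_1+z_2^{w_2}e_2$ for $Z=z_1e_1+z_2e_2$, $W=w_1e_1+w_2e_2$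 (principal complex powers). Identities are understood for $Z_0$ at which the occurring powers are defined (e.g. $pq\neq0$), and $t>0$. Bicomplex Miller-Ross function: $E_{\mathcal{V},C}(Z)=Z^{\mathcal{V}}\sum_{r=0}^{\infty}\frac{(CZ)^r}{\Gamma(\mathcal{V}+r+1)}$ for $\mathcal{V},C,Z\in\mathbb{BC}$. Riemann-Liouville differentiation of bicomplex order $M=\mu_1e_1+\mu_2e_2$ ($\mu_1=m_1-im_2$, $\mu_2=m_1+im_2$) is componentwise: $D_t^M(f_1e_1+f_2e_2)=(D_t^{\mu_1}f_1)e_1+(D_t^{\mu_2}f_2)e_2$, where for $\Re\mu<0$, $D_t^{\mu}g(t)=\frac{1}{\Gamma(-\mu)}\int_0^t(t-\tau)^{-\mu-1}g(\tau)d\tau$, and for $\Re\mu\ge0$, $D_t^\mu g=\frac{d^n}{dt^n}D_t^{\mu-n}g$ with $n=\lfloor\Re\mu\rfloor+1$. In particular $D_t^Mt^u=\frac{\Gamma(u+1)}{\Gamma(u-M+1)}t^{u-M}$ for real $u>-1$. *)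

theory Defs
  imports "HOL-Analysis.Analysis"
begin

section \<open>Bicomplex numbers\<close>

text \<open>\<open>BC w1 w2\<close> stands for \<open>w1 + j w2\<close>.\<close>

datatype bicomplex = BC (bc1: complex) (bc2: complex)

instantiation bicomplex :: comm_ring_1
begin

definition "0 = BC 0 0"
definition "1 = BC 1 0"
definition "Z + W = BC (bc1 Z + bc1 W) (bc2 Z + bc2 W)"
definition "- Z = BC (- bc1 Z) (- bc2 Z)"
definition "Z - W = BC (bc1 Z - bc1 W) (bc2 Z - bc2 W)"
definition "Z * W = BC (bc1 Z * bc1 W - bc2 Z * bc2 W) (bc1 Z * bc2 W + bc2 Z * bc1 W)"

instance
  by standard
    (auto simp: zero_bicomplex_def one_bicomplex_def plus_bicomplex_def uminus_bicomplex_def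
      minus_bicomplex_def times_bicomplex_def algebra_simps)

end

instantiation bicomplex :: real_algebra_1
begin

definition "r *\<^sub>R Z = BC (r *\<^sub>R bc1 Z) (r *\<^sub>R bc2 Z)"

instance
  by standard
    (auto simp: scaleR_bicomplex_def plus_bicomplex_def times_bicomplex_def algebra_simps)

end

instantiation bicomplex :: real_normed_vector
begin

definition "norm Z = sqrt ((cmod (bc1 Z))\<^sup>2 + (cmod (bc2 Z))\<^sup>2)"
definition "sgn (Z :: bicomplex) = Z /\<^sub>R norm Z"
definition "dist (Z :: bicomplex) W = norm (Z - W)"
definition [code del]:
  "(uniformity :: (bicomplex \<times> bicomplex) filter) =
     (INF e\<in>{0 <..}. principal {(Z, W). dist Z W < e})"
definition [code del]:
  "open (U :: bicomplex set) \<longleftrightarrow>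
     (\<forall>Z\<in>U. eventually (\<lambda>(Z', W). Z' = Z \<longrightarrow> W \<in> U) uniformity)"

instance
proof
  fix r :: real and Z W :: bicomplex and U :: "bicomplex set"
  have norm_pair: "norm X = norm (bc1 X, bc2 X)" for X
    by (simp add: norm_bicomplex_def norm_Pair)
  show "dist Z W = norm (Z - W)"
    by (rule dist_bicomplex_def)
  show "sgn Z = Z /\<^sub>R norm Z"
    by (rule sgn_bicomplex_def)
  show "(uniformity :: (bicomplex \<times> bicomplex) filter) =
     (INF e\<in>{0 <..}. principal {(Z, W). dist Z W < e})"
    by (rule uniformity_bicomplex_def)
  show "open U \<longleftrightarrow> (\<forall>Z\<in>U. eventually (\<lambda>(Z', W). Z' = Z \<longrightarrow> W \<in> U) uniformity)"
    by (rule open_bicomplex_def)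
  show "norm Z = 0 \<longleftrightarrow> Z = 0"
    by (cases Z) (simp add: norm_pair zero_bicomplex_def zero_prod_def)
  show "norm (Z + W) \<le> norm Z + norm W"
    using norm_triangle_ineq[of "(bc1 Z, bc2 Z)" "(bc1 W, bc2 W)"]
    by (simp add: norm_pair plus_bicomplex_def)
  show "norm (r *\<^sub>R Z) = \<bar>r\<bar> * norm Z"
    using norm_scaleR[of r "(bc1 Z, bc2 Z)"]
    by (simp add: norm_pair scaleR_bicomplex_def)
qed

end

definition bc_of_complex :: "complex \<Rightarrow> bicomplex" where
  "bc_of_complex w = BC w 0"

definition bc_j :: bicomplex where
  "bc_j = BC 0 1"

definition bc_e1 :: bicomplex where
  "bc_e1 = bc_of_complex (1 / 2) * (1 + bc_of_complex \<i> * bc_j)"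

definition bc_e2 :: bicomplex where
  "bc_e2 = bc_of_complex (1 / 2) * (1 - bc_of_complex \<i> * bc_j)"

definition bc_idem :: "complex \<Rightarrow> complex \<Rightarrow> bicomplex" where
  "bc_idem z1 z2 = bc_of_complex z1 * bc_e1 + bc_of_complex z2 * bc_e2"

definition bc_idem1 :: "bicomplex \<Rightarrow> complex" where
  "bc_idem1 Z = bc1 Z - \<i> * bc2 Z"

definition bc_idem2 :: "bicomplex \<Rightarrow> complex" where
  "bc_idem2 Z = bc1 Z + \<i> * bc2 Z"

lemmas bc_unfold = bc_of_complex_def bc_j_def bc_e1_def bc_e2_def bc_idem_def
  bc_idem1_def bc_idem2_def zero_bicomplex_def one_bicomplex_def plus_bicomplex_def
  minus_bicomplex_def uminus_bicomplex_def times_bicomplex_def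

lemma BC_eq: "BC w1 w2 = bc_of_complex w1 + bc_j * bc_of_complex w2"
  by (simp add: bc_unfold)

lemma bc_idem1_idem [simp]: "bc_idem1 (bc_idem z1 z2) = z1"
  and bc_idem2_idem [simp]: "bc_idem2 (bc_idem z1 z2) = z2"
  by (simp_all add: bc_unfold field_simps)

lemma bc_idem_idem12 [simp]: "bc_idem (bc_idem1 Z) (bc_idem2 Z) = Z"
  by (cases Z) (simp add: bc_unfold field_simps)

lemma bc_idem_mult: "bc_idem z1 z2 * bc_idem w1 w2 = bc_idem (z1 * w1) (z2 * w2)"
  by (simp add: bc_unfold field_simps)


section \<open>Componentwise functions and the Miller-Ross function\<close>

definition bc_rGamma :: "bicomplex \<Rightarrow> bicomplex" where
  "bc_rGamma Y = bc_idem (rGamma (bc_idem1 Y)) (rGamma (bc_idem2 Y))"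

definition bc_powr :: "bicomplex \<Rightarrow> bicomplex \<Rightarrow> bicomplex" where
  "bc_powr Z W = bc_idem (bc_idem1 Z powr bc_idem1 W) (bc_idem2 Z powr bc_idem2 W)"

text \<open>A complex power \<open>z powr w\<close> is defined for \<open>z \<noteq> 0\<close>, and for \<open>z = 0\<close> (with value \<open>0\<close>) when
  \<open>Re w > 0\<close>; otherwise the library's value \<open>0 powr w = 0\<close> is a mere convention.\<close>

definition bc_powr_defined :: "bicomplex \<Rightarrow> bicomplex \<Rightarrow> bool" where
  "bc_powr_defined Z W \<longleftrightarrow>
     (bc_idem1 Z \<noteq> 0 \<or> Re (bc_idem1 W) > 0) \<and> (bc_idem2 Z \<noteq> 0 \<or> Re (bc_idem2 W) > 0)"

definition miller_ross :: "bicomplex \<Rightarrow> bicomplex \<Rightarrow> bicomplex \<Rightarrow> bicomplex" where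
  "miller_ross V C Z = bc_powr Z V * (\<Sum>r. (C * Z) ^ r * bc_rGamma (V + of_nat r + 1))"


section \<open>Riemann-Liouville differentiation\<close>

text \<open>The operators act on functions on \<open>(0, \<infinity>)\<close>; values elsewhere are irrelevant. Since the
  library's integral and derivative are total, existence is stated by the predicates
  \<open>RL_exists\<close> and \<open>bc_RL_exists\<close>.\<close>

definition RL_integrand :: "complex \<Rightarrow> (real \<Rightarrow> complex) \<Rightarrow> real \<Rightarrow> real \<Rightarrow> complex" where
  "RL_integrand \<mu> g t \<tau> = complex_of_real (t - \<tau>) powr (- \<mu> - 1) * g \<tau>"

definition RL_neg :: "complex \<Rightarrow> (real \<Rightarrow> complex) \<Rightarrow> real \<Rightarrow> complex" where
  "RL_neg \<mu> g t = 1 / Gamma (- \<mu>) * integral {0..t} (RL_integrand \<mu> g t)"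

definition nth_vector_derivative :: "nat \<Rightarrow> (real \<Rightarrow> complex) \<Rightarrow> real \<Rightarrow> complex" where
  "nth_vector_derivative n = (\<lambda>h t. vector_derivative h (at t)) ^^ n"

definition RL_deg :: "complex \<Rightarrow> nat" where
  "RL_deg \<mu> = nat (\<lfloor>Re \<mu>\<rfloor> + 1)"

definition RL_deriv :: "complex \<Rightarrow> (real \<Rightarrow> complex) \<Rightarrow> real \<Rightarrow> complex" where
  "RL_deriv \<mu> g =
     (if Re \<mu> < 0 then RL_neg \<mu> g
      else nth_vector_derivative (RL_deg \<mu>) (RL_neg (\<mu> - of_nat (RL_deg \<mu>)) g))"

definition RL_neg_exists :: "complex \<Rightarrow> (real \<Rightarrow> complex) \<Rightarrow> bool" where
  "RL_neg_exists \<mu> g \<longleftrightarrow> (\<forall>t>0. RL_integrand \<mu> g t absolutely_integrable_on {0..t})"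

definition RL_exists :: "complex \<Rightarrow> (real \<Rightarrow> complex) \<Rightarrow> bool" where
  "RL_exists \<mu> g \<longleftrightarrow>
     (if Re \<mu> < 0 then RL_neg_exists \<mu> g
      else RL_neg_exists (\<mu> - of_nat (RL_deg \<mu>)) g \<and>
        (\<forall>k<RL_deg \<mu>. \<forall>t>0.
           nth_vector_derivative k (RL_neg (\<mu> - of_nat (RL_deg \<mu>)) g) differentiable (at t)))"

definition bc_RL_deriv :: "bicomplex \<Rightarrow> (real \<Rightarrow> bicomplex) \<Rightarrow> real \<Rightarrow> bicomplex" where
  "bc_RL_deriv M f t =
     bc_idem (RL_deriv (bc_idem1 M) (\<lambda>s. bc_idem1 (f s)) t) (RL_deriv (bc_idem2 M) (\<lambda>s. bc_idem2 (f s)) t)"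

definition bc_RL_exists :: "bicomplex \<Rightarrow> (real \<Rightarrow> bicomplex) \<Rightarrow> bool" where
  "bc_RL_exists M f \<longleftrightarrow>
     RL_exists (bc_idem1 M) (\<lambda>s. bc_idem1 (f s)) \<and> RL_exists (bc_idem2 M) (\<lambda>s. bc_idem2 (f s))"

end

theory Submission
  imports Defs
begin

text \<open>
  The two idempotent components of \<open>V\<close> are the real numbers \<open>\<alpha> \<plusminus> b\<close>, where \<open>\<beta> = \<i> b\<close>, and both
  exceed \<open>-1\<close>, so everything reduces to a complex Miller-Ross function with real exponent \<open>\<nu> > -1\<close>.
  For \<open>Re \<mu> < 0\<close> the series is integrated termwise with the complex Beta integral, which comes from
  Fubini applied to the convolution of two Gamma densities. For \<open>Re \<mu> \<ge> 0\<close> one differentiates the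
  resulting function: \<open>d/dt\<close> lowers the exponent by one, since \<open>z / \<Gamma>(z + 1) = 1 / \<Gamma>(z)\<close> holds at the
  poles as well.
\<close>

text \<open>Truncating the power to \<open>x > 0\<close> turns the integrals over \<open>[0, t]\<close> into convolutions over the
  whole line.\<close>

definition tpow :: "real \<Rightarrow> complex \<Rightarrow> complex" where
  "tpow x z = (if 0 < x then complex_of_real x powr z else 0)"

lemma borel_measurable_tpow [measurable]: "(\<lambda>x. tpow x z) \<in> borel_measurable borel"
proof -
  have "(\<lambda>x. tpow x z) = (\<lambda>x. if 0 < x then exp (z * complex_of_real (ln x)) else 0)"
    by (auto simp: tpow_def powr_def Ln_of_real)
  then show ?thesis by simp
qed

text \<open>Absolute values lead to truncated powers again, so the Beta integral will also evaluate
  the integrals of norms needed for exchanging sum and integral.\<close>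

lemma norm_tpow: "complex_of_real (norm (tpow x z)) = tpow x (of_real (Re z))"
  by (auto simp: tpow_def norm_powr_real_powr powr_of_real)

lemma norm_tpow_real: "norm (tpow x z) = (if 0 < x then x powr Re z else 0)"
  by (auto simp: tpow_def norm_powr_real_powr)

lemma tpow_mult: "0 < t \<Longrightarrow> tpow (t * x) z = tpow t z * tpow x z"
  by (auto simp: tpow_def zero_less_mult_iff powr_times_real_left)

lemma tpow_add: "tpow x (z + w) = tpow x z * tpow x w"
  by (auto simp: tpow_def powr_add)

section \<open>Euler's Gamma and Beta integrals for complex arguments\<close>

lemma Gamma_nonzero_if_Re_pos: "0 < Re z \<Longrightarrow> Gamma z \<noteq> 0"
  by (auto simp: Gamma_eq_zero_iff elim!: nonpos_Ints_cases')

text \<open>Euler's integral as a Bochner integral over the line, the form that Fubini requires;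
  absolute integrability allows the passage from the gauge integral.\<close>

lemma has_bochner_integral_Gamma:
  assumes "Re z > 0"
  shows "has_bochner_integral lborel (\<lambda>x. tpow x (z - 1) * of_real (exp (- x))) (Gamma z)"
proof -
  let ?g = "\<lambda>x. complex_of_real x powr (z - 1) / of_real (exp x)"
  have eq: "(\<lambda>x. tpow x (z - 1) * of_real (exp (- x))) = (\<lambda>x. indicator {0<..} x *\<^sub>R ?g x)"
    by (auto simp: tpow_def fun_eq_iff exp_minus field_simps)
  have meas: "(\<lambda>x. tpow x (z - 1) * of_real (exp (- x))) \<in> borel_measurable lborel"
    by simp
  have "?g absolutely_integrable_on {0<..}"
    using absolutely_integrable_Gamma_integral[of z 1] assms by simp
  then have int: "integrable lborel (\<lambda>x. tpow x (z - 1) * of_real (exp (- x)))"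
    using meas unfolding set_integrable_def eq by (simp add: integrable_completion)
  moreover have "set_lebesgue_integral lborel {0<..} ?g = Gamma z"
    using set_borel_integral_eq_integral(2)[of "{0<..}" ?g] int Gamma_integral_complex'[OF assms]
    by (simp add: set_integrable_def eq has_integral_iff)
  ultimately show ?thesis
    by (simp add: has_bochner_integral_iff set_lebesgue_integral_def eq)
qed

lemma integrable_tpow_convolution_1:
  assumes "Re a > 0" "Re b > 0"
  shows "integrable lborel (\<lambda>s. tpow s (a - 1) * tpow (1 - s) (b - 1))"
proof (rule Bochner_Integration.integrable_bound[OF _ _ AE_I2])
  show "integrable lborel (\<lambda>t. indicator {0..1} t *\<^sub>R (t powr (Re a - 1) *
      (1 - t) powr (Re b - 1)))"
    using integrable_Beta[OF assms] by (simp add: set_integrable_def)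
qed (auto simp: norm_mult norm_tpow_real indicator_def)

lemma tpow_convolution_scale:
  assumes "0 < t"
  shows "tpow (t * s) (a - 1) * tpow (t - t * s) (b - 1) * of_real t =
    tpow t (a + b - 1) * (tpow s (a - 1) * tpow (1 - s) (b - 1))"
proof -
  have "of_real t = tpow t 1"
    using assms by (simp add: tpow_def)
  moreover have "tpow (t - t * s) (b - 1) = tpow t (b - 1) * tpow (1 - s) (b - 1)"
    using tpow_mult[OF assms, of "1 - s"] by (simp add: algebra_simps)
  moreover have "tpow t (a + b - 1) = tpow t (a - 1) * tpow t (b - 1) * tpow t 1"
    by (simp flip: tpow_add add: algebra_simps)
  ultimately show ?thesis
    using assms by (simp add: tpow_mult)
qed

text \<open>The substitution \<open>s = t * u\<close> pulls all dependence on \<open>t\<close> out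
  as a power; the constant \<open>I\<close> is identified afterwards.\<close>

lemma tpow_convolution_by_scaling:
  assumes "Re a > 0" "Re b > 0"
  defines "I \<equiv> \<integral>s. tpow s (a - 1) * tpow (1 - s) (b - 1) \<partial>lborel"
  assumes t: "0 < t"
  shows "has_bochner_integral lborel (\<lambda>s. tpow s (a - 1) * tpow (t - s) (b - 1)) (I * tpow t (a + b - 1))"
proof -
  have "has_bochner_integral lborel (\<lambda>s. tpow s (a - 1) * tpow (1 - s) (b - 1)) I"
    using integrable_tpow_convolution_1[OF assms(1,2)] by (simp add: I_def has_bochner_integral_iff)
  from has_bochner_integral_mult_right[OF this, of "tpow t (a + b - 1) / of_real t"]
  have "has_bochner_integral lborel (\<lambda>s. tpow (0 + t * s) (a - 1) * tpow (t - (0 + t * s)) (b - 1))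
      (I * tpow t (a + b - 1) /\<^sub>R \<bar>t\<bar>)"
    using t tpow_convolution_scale[OF t, of _ a b, symmetric]
    by (simp add: scaleR_conv_of_real field_simps)
  then show ?thesis
    using t by (subst lborel_has_bochner_integral_real_affine_iff[of t _ _ 0]) auto
qed

text \<open>The convolution of \<open>G a\<close> and \<open>G b\<close> is
  \<open>I * G (a + b)\<close>, because the exponentials combine to \<open>exp (- u)\<close> and
  scaling handles the powers. Integrating over \<open>u\<close> in both orders gives
  \<open>I * Gamma (a + b) = Gamma a * Gamma b\<close>.\<close>

lemma integral_tpow_convolution_1:
  assumes a: "Re a > 0" and b: "Re b > 0"
  shows "(\<integral>s. tpow s (a - 1) * tpow (1 - s) (b - 1) \<partial>lborel) = Beta a b"
proof -
  define I where "I = (\<integral>s. tpow s (a - 1) * tpow (1 - s) (b - 1) \<partial>lborel)"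
  define G where "G z x = tpow x (z - 1) * of_real (exp (- x))" for z x
  have G: "has_bochner_integral lborel (G z) (Gamma z)" if "Re z > 0" for z
    unfolding G_def by (rule has_bochner_integral_Gamma[OF that])
  have G_meas [measurable]: "G z \<in> borel_measurable borel" for z
    unfolding G_def by simp
  have shift: "has_bochner_integral lborel (\<lambda>u. G b (u - s)) (Gamma b)" for s
    using iffD1[OF lborel_has_bochner_integral_real_affine_iff[of 1 "G b" "Gamma b" "-s"] G[OF b]] by simp
  have shiftn: "(\<integral>u. norm (G b (u - s)) \<partial>lborel) = (\<integral>u. norm (G b u) \<partial>lborel)" for s
    by (subst (2) lborel_integral_real_affine[of 1 _ "-s"]) simp_all
  \<comment> \<open>By translation invariance the inner integral of the norm is a constant multiple
    of \<open>norm (G a s)\<close>, which is integrable.\<close>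
  have int: "integrable (lborel \<Otimes>\<^sub>M lborel) (case_prod (\<lambda>s u. G a s * G b (u - s)))"
  proof (rule lborel_pair.Fubini_integrable)
    show "integrable lborel (\<lambda>x. \<integral>y. norm (case (x, y) of (s, u) \<Rightarrow> G a s * G b (u - s)) \<partial>lborel)"
      using G[OF a] by (simp add: norm_mult shiftn has_bochner_integral_iff)
    show "AE x in lborel. integrable lborel (\<lambda>y. case (x, y) of (s, u) \<Rightarrow> G a s * G b (u - s))"
      using shift by (simp add: has_bochner_integral_iff)
  qed simp
  have inner: "(\<integral>s. G a s * G b (u - s) \<partial>lborel) = I * G (a + b) u" for u
  proof (cases "u > 0")
    case True
    have "G a s * G b (u - s) = of_real (exp (- u)) * (tpow s (a - 1) * tpow (u - s) (b - 1))" for s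
      by (simp add: G_def mult_ac flip: of_real_mult exp_add)
    then have "(\<integral>s. G a s * G b (u - s) \<partial>lborel) = of_real (exp (- u)) * (I * tpow u (a + b - 1))"
      using tpow_convolution_by_scaling[OF a b True]
      by (simp add: has_bochner_integral_iff I_def)
    then show ?thesis by (simp add: G_def)
  next
    case False
    \<comment> \<open>For \<open>u \<le> 0\<close> the numbers \<open>s\<close> and
      \<open>u - s\<close> are never both positive, so one truncated power vanishes.\<close>
    then have "(\<lambda>s. G a s * G b (u - s)) = (\<lambda>_. 0)"
      by (auto simp: G_def tpow_def fun_eq_iff)
    then show ?thesis using False by (simp add: G_def tpow_def)
  qed
  have "I * Gamma (a + b) = (\<integral>u. I * G (a + b) u \<partial>lborel)"
    using G[of "a + b"] a b by (simp add: has_bochner_integral_iff)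
  also have "\<dots> = (\<integral>u. \<integral>s. G a s * G b (u - s) \<partial>lborel \<partial>lborel)"
    by (simp add: inner)
  also have "\<dots> = (\<integral>s. \<integral>u. G a s * G b (u - s) \<partial>lborel \<partial>lborel)"
    by (rule lborel_pair.Fubini_integral[OF int])
  also have "\<dots> = Gamma a * Gamma b"
    using G[OF a] shift by (simp add: has_bochner_integral_iff)
  finally have "I * Gamma (a + b) = Gamma a * Gamma b" .
  moreover have "Gamma (a + b) \<noteq> 0"
    using a b by (intro Gamma_nonzero_if_Re_pos) simp
  ultimately show ?thesis
    by (simp add: Beta_def I_def field_simps)
qed

lemma has_bochner_integral_tpow_convolution:
  assumes "Re a > 0" "Re b > 0" "0 < t"
  shows "has_bochner_integral lborel (\<lambda>s. tpow s (a - 1) * tpow (t - s) (b - 1))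
    (Beta a b * tpow t (a + b - 1))"
  using tpow_convolution_by_scaling[OF assms] integral_tpow_convolution_1[OF assms(1,2)] by simp

section \<open>The power series of the Miller-Ross function\<close>

text \<open>Ratio test: by \<open>rGamma w = w * rGamma (w + 1)\<close>, successive terms eventually
  shrink by the factor \<open>norm z / norm (a + of_nat n)\<close>. The bound \<open>N\<close> makes
  \<open>norm (a + of_nat n) \<ge> n - norm a > 2 * norm z\<close>, so this factor is at most
  1/2.\<close>

lemma summable_norm_rGamma_series:
  fixes a z :: complex
  shows "summable (\<lambda>r. norm (z ^ r * rGamma (a + of_nat r)))"
proof -
  obtain N :: nat where N: "norm a + 2 * norm z + 1 < N"
    using reals_Archimedean2 by blast
  show ?thesis
  proof (rule summable_ratio_test[of "1/2" N])
    fix n assume "N \<le> n"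
    with N have n: "norm a + 2 * norm z + 1 < real n"
      by linarith
    have "real n \<le> norm (a + of_nat n) + norm a"
      using norm_triangle_ineq4[of "a + of_nat n" a] by simp
    with n have big: "2 * norm z \<le> norm (a + of_nat n)" "0 < norm (a + of_nat n)"
      using norm_ge_zero[of z] by linarith+
    let ?u = "norm (z ^ n) * norm (rGamma (a + of_nat (Suc n)))"
    have "rGamma (a + of_nat n) = (a + of_nat n) * rGamma (a + of_nat (Suc n))"
      using rGamma_plus1[of "a + of_nat n"] by (simp add: add_ac)
    then have "norm (z ^ n * rGamma (a + of_nat n)) = norm (a + of_nat n) * ?u"
      by (simp add: norm_mult)
    moreover have "2 * norm z * ?u \<le> norm (a + of_nat n) * ?u"
      using big by (intro mult_right_mono) auto
    moreover have "norm (z ^ Suc n * rGamma (a + of_nat (Suc n))) = norm z * ?u"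
      by (simp only: norm_mult power_Suc mult.assoc)
    ultimately show "norm (norm (z ^ Suc n * rGamma (a + of_nat (Suc n))))
        \<le> 1 / 2 * norm (norm (z ^ n * rGamma (a + of_nat n)))"
      by simp
  qed simp
qed

text \<open>This is the two-parameter Mittag-Leffler function with parameters 1 and
  \<open>a + 1\<close>, entire in \<open>z\<close>.\<close>

definition miller_ross_series :: "complex \<Rightarrow> complex \<Rightarrow> complex" where
  "miller_ross_series a z = (\<Sum>r. z ^ r * rGamma (a + of_nat r + 1))"

lemma summable_norm_miller_ross_series: "summable (\<lambda>r. norm (z ^ r * rGamma (a + of_nat r + 1)))"
  for a z :: complex
  using summable_norm_rGamma_series[of z "a + 1"] by (simp add: add_ac)

lemma sums_miller_ross_series: "(\<lambda>r. z ^ r * rGamma (a + of_nat r + 1)) sums miller_ross_series a z"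
  unfolding miller_ross_series_def
  by (rule summable_sums[OF summable_norm_cancel[OF summable_norm_miller_ross_series]])

text \<open>Only the power of the real variable is kept. The product of components of
  \<open>C\<close> and \<open>Z0\<close> enters through \<open>x\<close>, the power of the component
  of \<open>Z0\<close> through the constant factor \<open>k\<close> below.\<close>

definition complex_miller_ross :: "complex \<Rightarrow> complex \<Rightarrow> real \<Rightarrow> complex" where
  "complex_miller_ross a x t = tpow t a * miller_ross_series a (x * of_real t)"

section \<open>Termwise Riemann-Liouville integration\<close>

lemma tpow_add_of_nat: "tpow x (z + of_nat n) = tpow x z * of_real x ^ n"
  by (auto simp: tpow_def powr_add powr_nat)

text \<open>With \<open>a = \<nu> + r + 1\<close>, the integral yields \<open>Beta a (- \<mu>) =
  Gamma a * Gamma (- \<mu>) * rGamma (a - \<mu>)\<close>, and the coefficient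
  \<open>rGamma a\<close> cancels \<open>Gamma a\<close>. The bound on \<open>\<nu>\<close> gives
  convergence for every \<open>r\<close>.\<close>

lemma has_bochner_integral_convolution_term:
  fixes \<nu> :: real and k x \<mu> :: complex
  assumes \<nu>: "-1 < \<nu>" and \<mu>: "Re \<mu> < 0" and t: "0 < t"
  shows "has_bochner_integral lborel
    (\<lambda>s. k * x ^ r * rGamma (of_real \<nu> + of_nat r + 1) *
        (tpow s (of_real \<nu> + of_nat r) * tpow (t - s) (- \<mu> - 1)))
    (k * Gamma (- \<mu>) * tpow t (of_real \<nu> - \<mu>) *
        ((x * of_real t) ^ r * rGamma (of_real \<nu> - \<mu> + of_nat r + 1)))"
proof -
  let ?a = "of_real \<nu> + of_nat r + 1 :: complex"
  have a: "Re ?a > 0"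
    using \<nu> by simp
  then have "rGamma ?a * Gamma ?a = 1"
    by (metis Gamma_nonzero_if_Re_pos left_inverse rGamma_inverse_Gamma)
  then have "k * x ^ r * rGamma ?a * (Beta ?a (- \<mu>) * tpow t (?a + - \<mu> - 1)) =
     k * x ^ r * Gamma (- \<mu>) * rGamma (?a + - \<mu>) * tpow t (of_real \<nu> - \<mu> + of_nat r)"
    by (simp add: Beta_altdef algebra_simps)
  also have "\<dots> = k * Gamma (- \<mu>) * tpow t (of_real \<nu> - \<mu>) *
      ((x * of_real t) ^ r * rGamma (of_real \<nu> - \<mu> + of_nat r + 1))"
    by (simp only: tpow_add_of_nat) (simp add: power_mult_distrib algebra_simps)
  finally have eq: "k * x ^ r * rGamma ?a * (Beta ?a (- \<mu>) * tpow t (?a + - \<mu> - 1)) = \<dots>" .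
  have "has_bochner_integral lborel (\<lambda>s. k * x ^ r * rGamma ?a *
      (tpow s (?a - 1) * tpow (t - s) (- \<mu> - 1)))
      (k * x ^ r * rGamma ?a * (Beta ?a (- \<mu>) * tpow t (?a + - \<mu> - 1)))"
    using \<mu> by (intro has_bochner_integral_mult_right
        has_bochner_integral_tpow_convolution a t) simp_all
  then show ?thesis
    unfolding eq by simp
qed

text \<open>Gamma is positive on the positive axis, so the coefficients of a series with real
  exponent \<open>\<nu> > -1\<close> equal their own moduli.\<close>

lemma norm_rGamma_of_real:
  assumes "0 < a"
  shows "of_real (norm (rGamma (complex_of_real a))) = rGamma (complex_of_real a)"
proof -
  have "0 < rGamma a"
    using Gamma_real_pos[OF assms] by (simp add: rGamma_inverse_Gamma)
  then show ?thesis
    by (simp only: rGamma_complex_of_real norm_of_real abs_of_pos)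
qed

lemma has_bochner_integral_convolution_complex_miller_ross:
  fixes \<nu> :: real and k x \<mu> :: complex
  assumes \<nu>: "-1 < \<nu>" and \<mu>: "Re \<mu> < 0" and t: "0 < t"
  shows "has_bochner_integral lborel (\<lambda>s. tpow (t - s) (- \<mu> - 1) *
      (k * complex_miller_ross (of_real \<nu>) x s))
     (Gamma (- \<mu>) * (k * complex_miller_ross (of_real \<nu> - \<mu>) x t))"
proof -
  \<comment> \<open>The parameters are abstracted because the norms of the terms are instances at
    \<open>norm k\<close>, \<open>norm x\<close> and \<open>Re \<mu>\<close>.\<close>
  define T where "T k x \<mu> r s = k * x ^ r * rGamma (of_real \<nu> + of_nat r + 1) *
     (tpow s (of_real \<nu> + of_nat r) * tpow (t - s) (- \<mu> - 1))" for k x \<mu> :: complex and r s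
  define v where "v k x \<mu> r = k * Gamma (- \<mu>) * tpow t (of_real \<nu> - \<mu>) *
     ((x * of_real t) ^ r * rGamma (of_real \<nu> - \<mu> + of_nat r + 1))" for k x \<mu> r
  have Tv: "has_bochner_integral lborel (T k x \<mu> r) (v k x \<mu> r)" if "Re \<mu> < 0" for k x \<mu> r
    unfolding T_def v_def using that by (intro has_bochner_integral_convolution_term \<nu> t)
  \<comment> \<open>The norm of a term is a term of the same shape, so the summability of the integrals of the norms
    follows from the value of the integrals.\<close>
  have norm_T: "of_real (norm (T k x \<mu> r s)) = T (norm k) (norm x) (Re \<mu>) r s" for r s
    using norm_rGamma_of_real[of "\<nu> + real r + 1"] \<nu>
    by (simp add: T_def norm_mult norm_power norm_tpow)
  \<comment> \<open>The integral of a norm is nonnegative, hence equal to its own modulus; this form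
    matches the absolute summability of \<open>v\<close>.\<close>
  have int_norm: "(\<integral>s. norm (T k x \<mu> r s) \<partial>lborel) = norm (v (norm k) (norm x) (Re \<mu>) r)" for r
  proof -
    have "complex_of_real (\<integral>s. norm (T k x \<mu> r s) \<partial>lborel) = v (norm k) (norm x) (Re \<mu>) r"
      using Tv[of "Re \<mu>" "norm k" "norm x" r] \<mu>
      by (simp add: has_bochner_integral_iff norm_T flip: integral_complex_of_real)
    then have "norm (v (norm k) (norm x) (Re \<mu>) r) =
        norm (complex_of_real (\<integral>s. norm (T k x \<mu> r s) \<partial>lborel))"
      by simp
    also have "\<dots> = (\<integral>s. norm (T k x \<mu> r s) \<partial>lborel)"
      unfolding norm_of_real by (intro abs_of_nonneg Bochner_Integration.integral_nonneg) simp
    finally show ?thesis ..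
  qed
  have T_eq: "T k x \<mu> r s = (tpow (t - s) (- \<mu> - 1) * k * tpow s (of_real \<nu>)) *
      ((x * of_real s) ^ r * rGamma (of_real \<nu> + of_nat r + 1))" for r s
    by (simp add: T_def tpow_add_of_nat power_mult_distrib mult_ac)
  have T_sums: "(\<lambda>r. T k x \<mu> r s) sums (tpow (t - s) (- \<mu> - 1) *
      (k * complex_miller_ross (of_real \<nu>) x s))" for s
    using sums_mult[OF sums_miller_ross_series,
        of "tpow (t - s) (- \<mu> - 1) * k * tpow s (of_real \<nu>)" "x * of_real s" "of_real \<nu>"]
    unfolding T_eq complex_miller_ross_def by (simp add: mult_ac)
  have T_summable: "summable (\<lambda>r. norm (T k x \<mu> r s))" for s
    unfolding T_eq norm_mult[of "tpow (t - s) (- \<mu> - 1) * k * tpow s (of_real \<nu>)"]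
    by (intro summable_mult summable_norm_miller_ross_series)
  have v_summable: "summable (\<lambda>r. norm (v k x \<mu> r))" for k x \<mu>
    unfolding v_def norm_mult[of "k * Gamma (- \<mu>) * tpow t (of_real \<nu> - \<mu>)"]
    by (intro summable_mult summable_norm_miller_ross_series)
  have v_sums: "v k x \<mu> sums (Gamma (- \<mu>) * (k * complex_miller_ross (of_real \<nu> - \<mu>) x t))"
    using sums_mult[OF sums_miller_ross_series, of "k * Gamma (- \<mu>) * tpow t (of_real \<nu> - \<mu>)"
        "x * of_real t" "of_real \<nu> - \<mu>"]
    unfolding v_def complex_miller_ross_def by (simp add: mult_ac)
  have T_int: "integrable lborel (T k x \<mu> r)" "integral\<^sup>L lborel (T k x \<mu> r) = v k x \<mu> r" for r
    using Tv[OF \<mu>] by (simp_all add: has_bochner_integral_iff)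
  have eq: "(\<lambda>s. \<Sum>r. T k x \<mu> r s) = (\<lambda>s. tpow (t - s) (- \<mu> - 1) *
      (k * complex_miller_ross (of_real \<nu>) x s))"
    using T_sums by (auto simp: sums_iff)
  have summ: "summable (\<lambda>r. \<integral>s. norm (T k x \<mu> r s) \<partial>lborel)"
    unfolding int_norm by (rule v_summable)
  have "integrable lborel (\<lambda>s. \<Sum>r. T k x \<mu> r s)"
    using T_int T_summable summ by (intro integrable_suminf) auto
  moreover have "(\<integral>s. (\<Sum>r. T k x \<mu> r s) \<partial>lborel) = (\<Sum>r. v k x \<mu> r)"
    using integral_suminf[of lborel "T k x \<mu>"] T_int T_summable summ by simp
  ultimately show ?thesis
    using v_sums unfolding eq by (simp add: has_bochner_integral_iff sums_iff)
qed

text \<open>\<open>f\<close> is prescribed only for positive arguments because the Miller-Ross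
  function itself is not truncated elsewhere.\<close>

lemma RL_neg_complex_miller_ross:
  fixes \<nu> :: real and k x \<mu> :: complex
  assumes \<nu>: "-1 < \<nu>" and \<mu>: "Re \<mu> < 0"
    and f: "\<And>t. 0 < t \<Longrightarrow> f t = k * complex_miller_ross (of_real \<nu>) x t"
  shows "RL_neg_exists \<mu> f" and "0 < t \<Longrightarrow> RL_neg \<mu> f t = k * complex_miller_ross (of_real \<nu> - \<mu>) x t"
proof -
  define F where "F t s = tpow (t - s) (- \<mu> - 1) * (k * complex_miller_ross (of_real \<nu>) x s)"
      for t s
  have F: "has_bochner_integral lborel (F t) (Gamma (- \<mu>) *
      (k * complex_miller_ross (of_real \<nu> - \<mu>) x t))" if "0 < t" for t
    unfolding F_def by (rule has_bochner_integral_convolution_complex_miller_ross[OF \<nu> \<mu> that])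
  \<comment> \<open>The truncations make \<open>F t\<close> vanish outside \<open>{0<..<t}\<close>,
    so the integral over the line is the one over \<open>{0..t}\<close>.\<close>
  have ind: "indicator {0..t} s *\<^sub>R F t s = F t s" for t s
    by (auto simp: F_def complex_miller_ross_def tpow_def indicator_def)
  have int: "set_integrable lborel {0..t} (F t)"
    and val: "set_lebesgue_integral lborel {0..t} (F t) = Gamma (- \<mu>) *
        (k * complex_miller_ross (of_real \<nu> - \<mu>) x t)" if "0 < t" for t
    using F[OF that] by (simp_all add: set_integrable_def set_lebesgue_integral_def ind
        has_bochner_integral_iff)
  \<comment> \<open>Nothing is known about \<open>f\<close> at \<open>0\<close>; the end points form
    a null set and are removed by the spike lemmas.\<close>
  have eq: "RL_integrand \<mu> f t s = F t s" if "s \<in> {0..t} - {0, t}" for t s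
    using that f by (auto simp: RL_integrand_def F_def tpow_def)
  show "RL_neg_exists \<mu> f"
    unfolding RL_neg_exists_def
  proof (intro allI impI)
    fix t :: real assume "0 < t"
    then have "F t absolutely_integrable_on {0..t}"
      using int[of t] integrable_completion[OF borel_measurable_integrable]
      unfolding set_integrable_def by blast
    then show "RL_integrand \<mu> f t absolutely_integrable_on {0..t}"
      by (rule absolutely_integrable_spike[of _ _ "{0, t}"]) (use eq in auto)
  qed
  show "RL_neg \<mu> f t = k * complex_miller_ross (of_real \<nu> - \<mu>) x t" if "0 < t"
  proof -
    have "integral {0..t} (RL_integrand \<mu> f t) = integral {0..t} (F t)"
      by (rule integral_spike[of "{0, t}"]) (use eq in auto)
    also have "\<dots> = Gamma (- \<mu>) * (k * complex_miller_ross (of_real \<nu> - \<mu>) x t)"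
      using set_borel_integral_eq_integral(2)[OF int[OF that]] val[OF that] by simp
    finally show ?thesis
      using \<mu> Gamma_nonzero_if_Re_pos[of "- \<mu>"] by (simp add: RL_neg_def)
  qed
qed

section \<open>Ordinary differentiation of the Miller-Ross function\<close>

text \<open>The operator \<open>a + z * d/dz\<close> multiplies the \<open>r\<close>-th coefficient
  by \<open>a + of_nat r\<close>, which lowers the argument of \<open>rGamma\<close> by one. Only
  this combination matters later, so \<open>D\<close> stays without a formula.\<close>

lemma miller_ross_series_derivative:
  obtains D where "(miller_ross_series a has_field_derivative D) (at z)"
    and "a * miller_ross_series a z + z * D = miller_ross_series (a - 1) z"
proof -
  define c where "c r = rGamma (a + of_nat r + 1)" for r :: nat
  have S: "(\<lambda>r. c r * y ^ r) sums miller_ross_series a y" for y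
    using sums_miller_ross_series[of y a] by (simp add: c_def mult.commute)
  then have eq: "miller_ross_series a = (\<lambda>y. \<Sum>r. c r * y ^ r)"
    by (simp add: sums_iff fun_eq_iff)
  define D where "D = (\<Sum>r. diffs c r * z ^ r)"
  have D: "(miller_ross_series a has_field_derivative D) (at z)"
    unfolding D_def eq by (rule termdiffs_strong_converges_everywhere) (use S in \<open>auto simp: sums_iff\<close>)
  \<comment> \<open>Unshifted, the derivative series aligns with \<open>S\<close>; at
    \<open>r = 0\<close> the factor \<open>of_nat r\<close> makes the truncated subtraction
    harmless.\<close>
  have "(\<lambda>r. of_nat r * c r * z ^ (r - Suc 0)) sums D"
    unfolding D_def by (rule diffs_equiv, rule termdiff_converges_all) (use S in \<open>auto simp: sums_iff\<close>)
  from sums_add[OF sums_mult[OF S[of z], of a] sums_mult[OF this, of z]]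
  have "(\<lambda>r. a * (c r * z ^ r) + z * (of_nat r * c r * z ^ (r - Suc 0))) sums
      (a * miller_ross_series a z + z * D)" .
  moreover have "a * (c r * z ^ r) + z * (of_nat r * c r * z ^ (r - Suc 0)) =
      z ^ r * rGamma (a - 1 + of_nat r + 1)" for r
  proof -
    have "z * (of_nat r * c r * z ^ (r - Suc 0)) = of_nat r * c r * z ^ r"
      by (cases r) auto
    moreover have "rGamma (a - 1 + of_nat r + 1) = (a + of_nat r) * c r"
      using rGamma_plus1[of "a + of_nat r"] by (simp add: c_def algebra_simps)
    ultimately show ?thesis
      by (simp add: algebra_simps)
  qed
  ultimately have "a * miller_ross_series a z + z * D = miller_ross_series (a - 1) z"
    using sums_miller_ross_series[of z "a - 1"] by (simp add: sums_iff)
  with D show ?thesis by (rule that)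
qed

text \<open>The complex derivative is taken at a positive real point, off the branch cut, and then
  restricted to the real line.\<close>

lemma complex_miller_ross_has_vector_derivative:
  assumes "0 < t"
  shows "(complex_miller_ross a x has_vector_derivative complex_miller_ross (a - 1) x t) (at t)"
proof -
  let ?z = "complex_of_real t"
  obtain D where D: "(miller_ross_series a has_field_derivative D) (at (x * ?z))"
    and D_eq: "a * miller_ross_series a (x * ?z) + x * ?z * D = miller_ross_series (a - 1) (x * ?z)"
    by (rule miller_ross_series_derivative)
  have "((\<lambda>z. miller_ross_series a (x * z)) has_field_derivative D * x) (at ?z)"
    using D by (rule DERIV_chain2) (auto intro!: derivative_eq_intros)
  moreover have "((\<lambda>z. z powr a) has_field_derivative a * ?z powr (a - 1)) (at ?z)"
    using assms by (intro has_field_derivative_powr) simp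
  ultimately have "((\<lambda>z. z powr a * miller_ross_series a (x * z)) has_field_derivative
      (a * ?z powr (a - 1) * miller_ross_series a (x * ?z) + D * x * ?z powr a)) (at ?z)"
    by (intro DERIV_mult)
  \<comment> \<open>This exposes the common factor \<open>?z powr (a - 1)\<close> and leaves the
    left side of \<open>D_eq\<close>.\<close>
  also have "?z powr a = ?z powr (a - 1) * ?z"
    using assms powr_add[of ?z "a - 1" 1] by simp
  also have "a * ?z powr (a - 1) * miller_ross_series a (x * ?z) + D * x * (?z powr (a - 1) * ?z) =
     ?z powr (a - 1) * (a * miller_ross_series a (x * ?z) + x * ?z * D)"
    by (simp add: algebra_simps)
  also have "\<dots> = complex_miller_ross (a - 1) x t"
    using assms by (simp add: D_eq complex_miller_ross_def tpow_def)
  finally have "((\<lambda>s. complex_of_real s powr a * miller_ross_series a (x * of_real s)) has_vector_derivative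
      complex_miller_ross (a - 1) x t) (at t)"
    by (rule has_vector_derivative_real_field)
  then show ?thesis
    by (rule has_vector_derivative_transform_within_open[of _ _ _ "{0<..}"])
       (use assms in \<open>auto simp: complex_miller_ross_def tpow_def\<close>)
qed

lemma has_vector_derivative_mult_complex_miller_ross:
  assumes "\<And>t. 0 < t \<Longrightarrow> h t = k * complex_miller_ross a x t" "0 < t"
  shows "(h has_vector_derivative k * complex_miller_ross (a - 1) x t) (at t)"
  by (rule has_vector_derivative_transform_within_open[of "\<lambda>t. k * complex_miller_ross a x t" _ _ "{0<..}"])
     (use assms in \<open>auto intro!: has_vector_derivative_mult_right complex_miller_ross_has_vector_derivative\<close>)

lemma nth_vector_derivative_mult_complex_miller_ross:
  assumes h: "\<And>t. 0 < t \<Longrightarrow> h t = k * complex_miller_ross a x t"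
  shows "0 < t \<Longrightarrow> nth_vector_derivative n h t = k * complex_miller_ross (a - of_nat n) x t"
\<comment> \<open>The hypothesis must hold at all positive points, since differentiating at
  \<open>t\<close> uses a neighbourhood of \<open>t\<close>.\<close>
proof (induction n arbitrary: t)
  case 0
  then show ?case by (simp add: nth_vector_derivative_def h)
next
  case (Suc n)
  have "nth_vector_derivative (Suc n) h t = vector_derivative (nth_vector_derivative n h) (at t)"
    by (simp add: nth_vector_derivative_def)
  also have "\<dots> = k * complex_miller_ross (a - of_nat n - 1) x t"
    by (intro vector_derivative_at has_vector_derivative_mult_complex_miller_ross Suc)
  finally show ?case by (simp add: algebra_simps)
qed

section \<open>Riemann-Liouville operators of arbitrary complex order\<close>

text \<open>For \<open>Re \<mu> \<ge> 0\<close> and \<open>n = RL_deg \<mu>\<close>, the integral of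
  order \<open>\<mu> - n\<close> changes the exponent to \<open>\<nu> - \<mu> + n\<close>, and
  \<open>n\<close> derivatives bring it to \<open>\<nu> - \<mu>\<close>.\<close>

lemma RL_deriv_mult_complex_miller_ross:
  fixes \<nu> :: real and k x \<mu> :: complex
  assumes \<nu>: "-1 < \<nu>" and f: "\<And>t. 0 < t \<Longrightarrow> f t = k * complex_miller_ross (of_real \<nu>) x t"
  shows "RL_exists \<mu> f" and "0 < t \<Longrightarrow> RL_deriv \<mu> f t = k * complex_miller_ross (of_real \<nu> - \<mu>) x t"
proof -
  have "RL_exists \<mu> f \<and> (\<forall>t>0. RL_deriv \<mu> f t = k * complex_miller_ross (of_real \<nu> - \<mu>) x t)"
  proof (cases "Re \<mu> < 0")
    case True
    have "RL_neg_exists \<mu> f" "\<And>t. 0 < t \<Longrightarrow> RL_neg \<mu> f t =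
        k * complex_miller_ross (of_real \<nu> - \<mu>) x t"
      using RL_neg_complex_miller_ross[OF \<nu> True, of f k x] f by blast+
    with True show ?thesis
      by (simp add: RL_exists_def RL_deriv_def)
  next
    case False
    let ?n = "RL_deg \<mu>"
    define h where "h = RL_neg (\<mu> - of_nat ?n) f"
    have neg: "Re (\<mu> - of_nat ?n) < 0"
      using False by (simp add: RL_deg_def)
    have exists: "RL_neg_exists (\<mu> - of_nat ?n) f"
      and h: "\<And>t. 0 < t \<Longrightarrow> h t = k * complex_miller_ross (of_real \<nu> - (\<mu> - of_nat ?n)) x t"
      unfolding h_def using RL_neg_complex_miller_ross[OF \<nu> neg, of f k x] f by blast+
    \<comment> \<open>The cases \<open>j < ?n\<close> give the differentiability required for
      existence, and \<open>j = ?n\<close> gives the value.\<close>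
    have D: "nth_vector_derivative j h t = k * complex_miller_ross (of_real \<nu> - (\<mu> - of_nat ?n) - of_nat j) x t"
      if "0 < t" for j t
      using h that by (rule nth_vector_derivative_mult_complex_miller_ross)
    have "nth_vector_derivative j h differentiable (at t)" if "0 < t" for j t
      using has_vector_derivative_mult_complex_miller_ross[OF D that]
          by (rule differentiableI_vector)
    moreover have "nth_vector_derivative ?n h t = k * complex_miller_ross (of_real \<nu> - \<mu>) x t"
        if "0 < t" for t
      using D[OF that, of ?n] by simp
    ultimately show ?thesis
      using False exists by (simp add: RL_exists_def RL_deriv_def h_def)
  qed
  then show "RL_exists \<mu> f" and "0 < t \<Longrightarrow> RL_deriv \<mu> f t =
      k * complex_miller_ross (of_real \<nu> - \<mu>) x t"
    by blast+
qed

section \<open>Passage to bicomplex numbers through idempotent components\<close>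

lemma bc_eqI: "bc_idem1 Z = bc_idem1 W \<Longrightarrow> bc_idem2 Z = bc_idem2 W \<Longrightarrow> Z = W"
  by (metis bc_idem_idem12)

lemma bc_idem_hom [simp]:
  "bc_idem1 (Z + W) = bc_idem1 Z + bc_idem1 W" "bc_idem2 (Z + W) = bc_idem2 Z + bc_idem2 W"
  "bc_idem1 (Z - W) = bc_idem1 Z - bc_idem1 W" "bc_idem2 (Z - W) = bc_idem2 Z - bc_idem2 W"
  "bc_idem1 (Z * W) = bc_idem1 Z * bc_idem1 W" "bc_idem2 (Z * W) = bc_idem2 Z * bc_idem2 W"
  "bc_idem1 0 = 0" "bc_idem2 0 = 0" "bc_idem1 1 = 1" "bc_idem2 1 = 1"
  by (simp_all add: bc_unfold algebra_simps)

lemma bc_idem_power [simp]: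
  "bc_idem1 (Z ^ n) = bc_idem1 Z ^ n" "bc_idem2 (Z ^ n) = bc_idem2 Z ^ n"
  by (induction n) auto

lemma bc_idem_of_nat [simp]: "bc_idem1 (of_nat n) = of_nat n" "bc_idem2 (of_nat n) = of_nat n"
  by (induction n) auto

lemma bc_idem_of_real [simp]: "bc_idem1 (of_real t) = of_real t" "bc_idem2 (of_real t) = of_real t"
  by (simp_all add: of_real_def scaleR_bicomplex_def one_bicomplex_def bc_idem1_def bc_idem2_def)

text \<open>Continuity of the two embeddings carries convergent component series into bicomplex
  ones.\<close>

lemma bounded_linear_bc_idem_left: "bounded_linear (\<lambda>z. bc_idem z 0)"
  and bounded_linear_bc_idem_right: "bounded_linear (\<lambda>z. bc_idem 0 z)"
proof -
  have "norm (bc_idem z 0) \<le> norm z * 1" "norm (bc_idem 0 z) \<le> norm z * 1" for z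
    using sqrt_sum_squares_le_sum[of "norm z / 2" "norm z / 2"]
    by (auto simp: norm_bicomplex_def bc_unfold norm_mult norm_divide power_divide)
  then show "bounded_linear (\<lambda>z. bc_idem z 0)" "bounded_linear (\<lambda>z. bc_idem 0 z)"
    by (auto intro!: bounded_linear_intro[of _ 1])
       (simp_all add: bc_unfold scaleR_bicomplex_def field_simps)
qed

lemma bc_sumsI:
  assumes "(\<lambda>r. bc_idem1 (f r)) sums a" "(\<lambda>r. bc_idem2 (f r)) sums b"
  shows "f sums bc_idem a b"
proof -
  have split: "bc_idem z w = bc_idem z 0 + bc_idem 0 w" for z w
    by (simp add: bc_unfold field_simps)
  have "(\<lambda>r. bc_idem (bc_idem1 (f r)) 0 + bc_idem 0 (bc_idem2 (f r))) sums
      (bc_idem a 0 + bc_idem 0 b)"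
    by (intro sums_add bounded_linear.sums[OF bounded_linear_bc_idem_left]
        bounded_linear.sums[OF bounded_linear_bc_idem_right] assms)
  then show ?thesis
    by (simp flip: split)
qed

lemma bc_rGamma_idem [simp]:
  "bc_idem1 (bc_rGamma Z) = rGamma (bc_idem1 Z)" "bc_idem2 (bc_rGamma Z) = rGamma (bc_idem2 Z)"
  by (simp_all add: bc_rGamma_def)

lemma bc_powr_idem [simp]:
  "bc_idem1 (bc_powr Z W) = bc_idem1 Z powr bc_idem1 W"
  "bc_idem2 (bc_powr Z W) = bc_idem2 Z powr bc_idem2 W"
  by (simp_all add: bc_powr_def)

text \<open>The \<open>suminf\<close> splits into components once convergence in the bicomplex norm
  is known, which \<open>bc_sumsI\<close> supplies.\<close>

lemma miller_ross_idem:
  "bc_idem1 (miller_ross V C Z) =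
      bc_idem1 Z powr bc_idem1 V * miller_ross_series (bc_idem1 V) (bc_idem1 C * bc_idem1 Z)"
  "bc_idem2 (miller_ross V C Z) =
      bc_idem2 Z powr bc_idem2 V * miller_ross_series (bc_idem2 V) (bc_idem2 C * bc_idem2 Z)"
proof -
  have "(\<lambda>r. (C * Z) ^ r * bc_rGamma (V + of_nat r + 1)) sums
     bc_idem (miller_ross_series (bc_idem1 V) (bc_idem1 C * bc_idem1 Z))
       (miller_ross_series (bc_idem2 V) (bc_idem2 C * bc_idem2 Z))"
    by (rule bc_sumsI) (simp_all add: sums_miller_ross_series)
  then show "bc_idem1 (miller_ross V C Z) =
      bc_idem1 Z powr bc_idem1 V * miller_ross_series (bc_idem1 V) (bc_idem1 C * bc_idem1 Z)"
    "bc_idem2 (miller_ross V C Z) =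
      bc_idem2 Z powr bc_idem2 V * miller_ross_series (bc_idem2 V) (bc_idem2 C * bc_idem2 Z)"
    by (simp_all add: miller_ross_def sums_iff)
qed

text \<open>A positive real factor leaves the argument of \<open>z\<close> unchanged, so the
  principal power is multiplicative here.\<close>

lemma powr_mult_miller_ross_series:
  assumes "0 < t"
  shows "(z * of_real t) powr v * miller_ross_series v (c * (z * of_real t)) =
      z powr v * complex_miller_ross v (c * z) t"
  using powr_times_real_left[of "of_real t" z v] assms
  by (simp add: complex_miller_ross_def tpow_def mult_ac)

lemma RL_deriv_miller_ross_component:
  fixes \<nu> :: real and z c \<mu> :: complex
  assumes \<nu>: "-1 < \<nu>"
  defines "f \<equiv> \<lambda>t. (z * of_real t) powr of_real \<nu> *
      miller_ross_series (of_real \<nu>) (c * (z * of_real t))"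
  shows "RL_exists \<mu> f"
    and "0 < t \<Longrightarrow> RL_deriv \<mu> f t = z powr \<mu> *
      ((z * of_real t) powr (of_real \<nu> - \<mu>) *
        miller_ross_series (of_real \<nu> - \<mu>) (c * (z * of_real t)))"
proof -
  have f: "f t = z powr of_real \<nu> * complex_miller_ross (of_real \<nu>) (c * z) t" if "0 < t" for t
    unfolding f_def using that by (rule powr_mult_miller_ross_series)
  show "RL_exists \<mu> f"
    using \<nu> f by (rule RL_deriv_mult_complex_miller_ross)
  \<comment> \<open>At \<open>z = 0\<close> all three powers have the value 0, and the identity
    reads \<open>0 = 0 * 0\<close>.\<close>
  have "z powr of_real \<nu> = z powr \<mu> * z powr (of_real \<nu> - \<mu>)"
    using powr_add[of z \<mu> "of_real \<nu> - \<mu>"] by simp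
  then show "RL_deriv \<mu> f t = z powr \<mu> *
      ((z * of_real t) powr (of_real \<nu> - \<mu>) *
        miller_ross_series (of_real \<nu> - \<mu>) (c * (z * of_real t)))" if "0 < t"
    using RL_deriv_mult_complex_miller_ross(2)[of \<nu> f _ _ t \<mu>, OF \<nu> f that]
        by (simp add: powr_mult_miller_ross_series[OF that])
qed

theorem theorem6p4:
  fixes Z0 V C M :: bicomplex and \<alpha> :: real and \<beta> m1 m2 :: complex
  assumes V: "V = BC (complex_of_real \<alpha>) \<beta>"
    and \<beta>: "\<exists>b::real. \<beta> = \<i> * complex_of_real b"
    and \<alpha>\<beta>: "\<alpha> + 1 > cmod \<beta>"
    and M: "M = BC m1 m2"
    and m1: "Re m1 > 0"
    and powers: "bc_powr_defined Z0 V" "bc_powr_defined Z0 M" "bc_powr_defined Z0 (V - M)"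
  shows "bc_RL_exists M (\<lambda>t. miller_ross V C (Z0 * of_real t)) \<and>
    (\<forall>t>0. bc_RL_deriv M (\<lambda>t. miller_ross V C (Z0 * of_real t)) t =
       bc_powr Z0 M * miller_ross (V - M) C (Z0 * of_real t))"
proof -
  obtain b where b: "\<beta> = \<i> * complex_of_real b"
    using \<beta> by blast
  \<comment> \<open>Since \<open>\<i> * \<beta> = - b\<close>, the component
    \<open>\<alpha> - \<i> * \<beta>\<close> becomes \<open>\<alpha> + b\<close>.\<close>
  have \<nu>: "bc_idem1 V = of_real (\<alpha> + b)" "bc_idem2 V = of_real (\<alpha> - b)"
    by (simp_all add: V b bc_idem1_def bc_idem2_def)
  have gt: "-1 < \<alpha> + b" "-1 < \<alpha> - b"
    using \<alpha>\<beta> by (auto simp: b norm_mult)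
  have exists: "RL_exists (bc_idem1 M) (\<lambda>t. bc_idem1 (miller_ross V C (Z0 * of_real t)))"
    "RL_exists (bc_idem2 M) (\<lambda>t. bc_idem2 (miller_ross V C (Z0 * of_real t)))"
    unfolding miller_ross_idem bc_idem_hom bc_idem_of_real \<nu>
    by (intro RL_deriv_miller_ross_component gt)+
  moreover have "bc_RL_deriv M (\<lambda>t. miller_ross V C (Z0 * of_real t)) t =
       bc_powr Z0 M * miller_ross (V - M) C (Z0 * of_real t)" if "0 < t" for t
    by (rule bc_eqI; unfold bc_RL_deriv_def bc_idem1_idem bc_idem2_idem miller_ross_idem bc_idem_hom
        bc_idem_of_real bc_powr_idem \<nu>)
      (intro RL_deriv_miller_ross_component gt that)+
  ultimately show ?thesis
    by (simp add: bc_RL_exists_def)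
qed

end
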